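(* For every integer $k\geq 0$, the $q$-expansion of the normalised extremal quasi-modular form $f_{1,6k}$ of weight $6k$ and depth $\leq 1$ has coefficients in $\mathbb{Z}[\frac{1}{p}: p \text{ prime},\ p<6k]$, i.e. $f_{1,6k}\in \mathbb{Z}[\frac{1}{p}:p<6k][[q]]$.
   Context: Let $q=e^{2\pi iz}$ and $E_2=1-24\sum_{n\ge1}\sigma_1(n)q^n$, $E_4=1+240\sum_{n\ge1}\sigma_3(n)q^n$, $E_6=1-504\sum_{n\ge1}\sigma_5(n)q^n$, with $\sigma_k(n)=\sum_{d\mid n}d^k$. Quasi-modular forms of weight $w$ and depth $\leq l$ are the elements of $\mathbb{C}[E_2,E_4,E_6]$ homogeneous of weight $w$ (weights $2,4,6$) and of degree $\leq l$ in $E_2$, identified with their $q$-expansions. $f_{1,6k}$ denotes the unique non-zero quasi-modular form of weight $6k$ and depth $\leq 1$ whose order of vanishing at $q=0$ is maximal among all non-zero such forms and whose first non-zero $q$-coefficient equals $1$ (this order equals $k$). *)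

theory Defs
  imports Complex_Main "HOL-Computational_Algebra.Computational_Algebra"
begin

definition divisor_sum :: "nat \<Rightarrow> nat \<Rightarrow> nat" where
  "divisor_sum k n = (\<Sum>d | d dvd n. d ^ k)"

text \<open>Modular objects are identified with their expansions in \<open>q\<close>, i.e. with formal power
  series over the complex numbers.\<close>

definition E2 :: "complex fps" where
  "E2 = Abs_fps (\<lambda>n. if n = 0 then 1 else - 24 * of_nat (divisor_sum 1 n))"

definition E4 :: "complex fps" where
  "E4 = Abs_fps (\<lambda>n. if n = 0 then 1 else 240 * of_nat (divisor_sum 3 n))"

definition E6 :: "complex fps" where
  "E6 = Abs_fps (\<lambda>n. if n = 0 then 1 else - 504 * of_nat (divisor_sum 5 n))"

text \<open>The exponents of the monomials \<open>E2^a E4^b E6^c\<close> of weight \<open>w\<close> and of degree at most \<open>l\<close>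
  in \<open>E2\<close>; a form of weight \<open>w\<close> and depth at most \<open>l\<close> is a linear combination of these
  monomials (the zero form included).\<close>

definition qm_exponents :: "nat \<Rightarrow> nat \<Rightarrow> (nat \<times> nat \<times> nat) set" where
  "qm_exponents l w = {(a, b, c). 2 * a + 4 * b + 6 * c = w \<and> a \<le> l}"

definition quasi_modular_forms :: "nat \<Rightarrow> nat \<Rightarrow> complex fps set" where
  "quasi_modular_forms l w =
     {f. \<exists>u :: nat \<Rightarrow> nat \<Rightarrow> nat \<Rightarrow> complex.
           f = (\<Sum>(a, b, c)\<in>qm_exponents l w. fps_const (u a b c) * E2 ^ a * E4 ^ b * E6 ^ c)}"

definition is_normalised_extremal :: "nat \<Rightarrow> nat \<Rightarrow> complex fps \<Rightarrow> bool" where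
  "is_normalised_extremal l w f \<longleftrightarrow>
     f \<in> quasi_modular_forms l w \<and> f \<noteq> 0 \<and>
     (\<forall>g\<in>quasi_modular_forms l w. g \<noteq> 0 \<longrightarrow> subdegree g \<le> subdegree f) \<and>
     fps_nth f (subdegree f) = 1"

text \<open>The form \<open>f\<^sub>l\<^sub>,\<^sub>w\<close>. Nothing can be derived about it before existence and uniqueness of the
  normalised extremal form have been established.\<close>

definition extremal_form :: "nat \<Rightarrow> nat \<Rightarrow> complex fps" where
  "extremal_form l w = (THE f. is_normalised_extremal l w f)"

text \<open>The subring \<open>\<int>[S]\<close> generated by \<open>S\<close>; closure under negation follows from \<open>-1 \<in> \<int>\<close>.\<close>

inductive_set int_adjoin :: "'a :: comm_ring_1 set \<Rightarrow> 'a set" for S :: "'a set" where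
  of_int: "of_int m \<in> int_adjoin S"
| gen: "x \<in> S \<Longrightarrow> x \<in> int_adjoin S"
| add: "x \<in> int_adjoin S \<Longrightarrow> y \<in> int_adjoin S \<Longrightarrow> x + y \<in> int_adjoin S"
| mult: "x \<in> int_adjoin S \<Longrightarrow> y \<in> int_adjoin S \<Longrightarrow> x * y \<in> int_adjoin S"

end

theory Submission
  imports Defs
begin

text \<open>Let \<open>D = q d/dq\<close> and \<open>\<Delta> = (E4\<^sup>3 - E6\<^sup>2) / 1728\<close>. Put \<open>F\<^sub>0 = 1\<close>, \<open>F\<^sub>1 = (E2 E4 - E6) / 720\<close> and
  \<open>12 (6n + 1) (6n + 5) F\<^bsub>n+1\<^esub> = n (n + 1) (\<Delta> F\<^bsub>n-1\<^esub> - E6 F\<^sub>n)\<close> for \<open>n \<ge> 1\<close>;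
  \<open>F\<^sub>n\<close> is a form of weight \<open>6n\<close> and depth \<open>\<le> 1\<close>. By Ramanujan's differential equations the pair \<open>(F\<^bsub>n-1\<^esub>, F\<^sub>n)\<close> satisfies a first-order
  linear system, from which
  \<open>F\<^sub>n = q\<^sup>n + 12n(4n - 1)/(n + 1) q\<^bsup>n+1\<^esup> + \<dots>\<close> follows by induction. Since the space of weight
  \<open>6(n + 1)\<close> is \<open>E6\<close> times the space of weight \<open>6n\<close> plus one further dimension, a nonzero form of
  weight \<open>6n\<close> vanishes to order at most \<open>n\<close>, so \<open>F\<^sub>n\<close> is the normalised extremal form. The recursion
  only divides by \<open>2\<close>, \<open>3\<close>, \<open>6n + 1\<close> and \<open>6n + 5\<close>, all smaller than \<open>6(n + 1)\<close>.

  Ramanujan's equations amount to convolution identities for divisor sums. These come from the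
  bijection \<open>(a, b, x, y) \<mapsto> (a, a + b, x - y, y)\<close> between solutions of
  \<open>ax + by = n\<close> with \<open>x > y\<close> and solutions with \<open>a < b\<close>, applied to forms \<open>h(a, b)\<close> invariant under the Weyl group of type \<open>A\<^sub>2\<close>:
  powers of \<open>a\<^sup>2 + ab + b\<^sup>2\<close>, and \<open>(ab(a + b))\<^sup>2\<close>.\<close>

section \<open>Convolutions of divisor sums\<close>

definition two_term_reps :: "nat \<Rightarrow> (nat \<times> nat \<times> nat \<times> nat) set" where
  "two_term_reps n = {(a, b, x, y). 0 < a \<and> 0 < b \<and> 0 < x \<and> 0 < y \<and> a * x + b * y = n}"

lemma finite_two_term_reps: "finite (two_term_reps n)"
proof (rule finite_subset)
  show "two_term_reps n \<subseteq> {..n} \<times> {..n} \<times> {..n} \<times> {..n}"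
  proof (clarsimp simp: two_term_reps_def)
    fix a b x y :: nat
    assume "0 < a" "0 < b" "0 < x" "0 < y"
    then have "a * 1 \<le> a * x" "1 * x \<le> a * x" "b * 1 \<le> b * y" "1 * y \<le> b * y"
      by (intro mult_le_mono; simp)+
    then show "a \<le> a * x + b * y \<and> b \<le> a * x + b * y \<and> x \<le> a * x + b * y \<and> y \<le> a * x + b * y"
      by linarith
  qed
qed simp

lemma sum_two_term_reps_split:
  fixes u v :: "nat \<times> nat \<times> nat \<times> nat \<Rightarrow> nat" and F :: "_ \<Rightarrow> 'a :: comm_monoid_add"
  shows "sum F (two_term_reps n) = sum F {t \<in> two_term_reps n. u t = v t}
    + sum F {t \<in> two_term_reps n. u t < v t} + sum F {t \<in> two_term_reps n. v t < u t}"
proof -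
  have "two_term_reps n = {t \<in> two_term_reps n. u t = v t} \<union> {t \<in> two_term_reps n. u t < v t}
      \<union> {t \<in> two_term_reps n. v t < u t}" by auto
  then have "sum F (two_term_reps n) = sum F ({t \<in> two_term_reps n. u t = v t}
      \<union> {t \<in> two_term_reps n. u t < v t} \<union> {t \<in> two_term_reps n. v t < u t})" by simp
  also have "\<dots> = sum F {t \<in> two_term_reps n. u t = v t}
      + sum F {t \<in> two_term_reps n. u t < v t} + sum F {t \<in> two_term_reps n. v t < u t}"
    by (subst sum.union_disjoint; (subst sum.union_disjoint)?)
      (auto simp: finite_two_term_reps)
  finally show ?thesis .
qed

text \<open>The sum of \<open>h(a, b)\<close> is split by comparing \<open>x\<close> with
  \<open>y\<close>, that of \<open>h(a, b - a)\<close> by comparing \<open>a\<close> with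
  \<open>b\<close>. The off-diagonal pieces match in pairs under the two bijections, so only the
  diagonals \<open>x = y\<close> and \<open>a = b\<close> survive, and these are sums over divisors
  of \<open>n\<close>.\<close>

lemma liouville_identity:
  fixes h :: "'a \<Rightarrow> 'a \<Rightarrow> 'a :: comm_ring_1"
  assumes n: "0 < n"
    and swap: "\<And>x y. h x y = h y x" and shear: "\<And>x y. h x y = h (x + y) (- y)"
  shows "(\<Sum>(a, b, x, y)\<in>two_term_reps n.
            h (of_nat a) (of_nat b) - h (of_nat a) (of_nat b - of_nat a))
         + (\<Sum>d | d dvd n. (of_nat (n div d) - 1) * h (of_nat d) 0)
       = (\<Sum>d | d dvd n. \<Sum>a\<in>{1..<d}. h (of_nat a) (of_nat d - of_nat a))"
proof -
  define p where "p = (\<lambda>(a, b, x :: nat, y :: nat). h (of_nat a) (of_nat b))"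
  define r where "r = (\<lambda>(a, b, x :: nat, y :: nat). h (of_nat a) (of_nat b - of_nat a))"
  let ?S = "two_term_reps n"
  let ?a = "\<lambda>t :: nat \<times> nat \<times> nat \<times> nat. fst t" and ?b = "\<lambda>t :: nat \<times> nat \<times> nat \<times> nat. fst (snd t)"
  let ?x = "\<lambda>t :: nat \<times> nat \<times> nat \<times> nat. fst (snd (snd t))"
  let ?y = "\<lambda>t :: nat \<times> nat \<times> nat \<times> nat. snd (snd (snd t))"
  have fin: "finite {d. d dvd n}" using n by simp
  \<comment> \<open>This is \<open>h(a + b, -a) = h(a, b)\<close> for \<open>a = 1 + x\<close>,
    \<open>b = 1 + y\<close>, the shape left once positive numbers are written as
    successors.\<close>
  have shear_Suc: "h (x + (y + 2)) (- 1 - x) = h (1 + x) (1 + y)" for x y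
    using shear[of "1 + y" "1 + x"] swap[of "1 + x" "1 + y"] by (simp add: algebra_simps)
  have gt: "sum p {t \<in> ?S. ?y t < ?x t} = sum r {t \<in> ?S. ?a t < ?b t}"
    by (rule sum.reindex_bij_witness[where i = "\<lambda>(a, b, x, y). (a, b - a, x + y, y)"
          and j = "\<lambda>(a, b, x, y). (a, a + b, x - y, y)"])
      (auto simp: two_term_reps_def p_def r_def algebra_simps dest!: less_imp_Suc_add)
  \<comment> \<open>The mirror image of the previous bijection: \<open>(a, b, x, y)\<close> goes to
    \<open>(a + b, b, x, y - x)\<close>. Here the summand becomes \<open>h(a + b, -a)\<close>, so
    invariance under shear and swap is used.\<close>
  have lt: "sum p {t \<in> ?S. ?x t < ?y t} = sum r {t \<in> ?S. ?b t < ?a t}"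
    by (rule sum.reindex_bij_witness[where i = "\<lambda>(a, b, x, y). (a - b, b, x, x + y)"
          and j = "\<lambda>(a, b, x, y). (a + b, b, x, y - x)"])
      (auto simp: two_term_reps_def p_def r_def algebra_simps
        shear_Suc dest!: less_imp_Suc_add)
  have div_pos: "0 < n div d" if "d dvd n" for d
    using that n by (auto elim!: dvdE)
  have part: "a * (n div d) + (d - a) * (n div d) = n" if "d dvd n" "a < d" for a d
    using that by (simp flip: distrib_right)
  have part': "d * x + d * (n div d - x) = n" if "d dvd n" "x < n div d" for d x
    using that by (simp flip: distrib_left)
  \<comment> \<open>With \<open>x = y\<close> the equation reads \<open>(a + b) x = n\<close>: the
    divisor is \<open>d = a + b\<close>, and \<open>a\<close> runs below \<open>d\<close>.\<close>
  have "sum p {t \<in> ?S. ?x t = ?y t} =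
      (\<Sum>(d, a)\<in>(SIGMA d:{d. d dvd n}. {1..<d}). h (of_nat a) (of_nat d - of_nat a))"
    by (rule sum.reindex_bij_witness[where i = "\<lambda>(d, a). (a, d - a, n div d, n div d)"
          and j = "\<lambda>(a, b, x, y). (a + b, a)"])
      (use n in \<open>auto simp: two_term_reps_def p_def div_pos part simp flip: distrib_right\<close>)
  then have xy: "sum p {t \<in> ?S. ?x t = ?y t} =
      (\<Sum>d | d dvd n. \<Sum>a\<in>{1..<d}. h (of_nat a) (of_nat d - of_nat a))"
    by (simp add: sum.Sigma fin)
  \<comment> \<open>With \<open>a = b\<close> it reads \<open>a (x + y) = n\<close>: the divisor is
    \<open>d = a\<close>, and \<open>x\<close> takes \<open>n div d - 1\<close> values.\<close>
  have "sum r {t \<in> ?S. ?a t = ?b t} =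
      (\<Sum>(d, x)\<in>(SIGMA d:{d. d dvd n}. {1..<n div d}). h (of_nat d) 0)"
    by (rule sum.reindex_bij_witness[where i = "\<lambda>(d, x). (d, d, x, n div d - x)"
          and j = "\<lambda>(a, b, x, y). (a, x)"])
      (use n in \<open>auto simp: two_term_reps_def r_def part' simp flip: distrib_left intro: Nat.gr0I\<close>)
  then have ab: "sum r {t \<in> ?S. ?a t = ?b t} = (\<Sum>d | d dvd n. \<Sum>x\<in>{1..<n div d}. h (of_nat d) 0)"
    by (subst sum.Sigma) (simp_all add: fin)
  have "(\<Sum>d | d dvd n. \<Sum>x\<in>{1..<n div d}. h (of_nat d) 0)
      = (\<Sum>d | d dvd n. (of_nat (n div d) - 1) * h (of_nat d :: 'a) 0)"
  proof (rule sum.cong[OF refl])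
    fix d assume "d \<in> {d. d dvd n}"
    then have "0 < n div d" by (simp add: div_pos)
    then show "(\<Sum>x\<in>{1..<n div d}. h (of_nat d) 0) = (of_nat (n div d) - 1) * h (of_nat d :: 'a) 0"
      by (simp add: of_nat_diff)
  qed
  moreover have "sum p ?S - sum r ?S = (\<Sum>(a, b, x, y)\<in>?S.
            h (of_nat a) (of_nat b) - h (of_nat a) (of_nat b - of_nat a))"
    by (simp add: p_def r_def case_prod_beta sum_subtractf)
  moreover have "sum p ?S - sum r ?S = sum p {t \<in> ?S. ?x t = ?y t} - sum r {t \<in> ?S. ?a t = ?b t}"
    using sum_two_term_reps_split[of p n ?x ?y] sum_two_term_reps_split[of r n ?a ?b] gt lt by simp
  ultimately show ?thesis
    using xy ab by (simp add: algebra_simps)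
qed

section \<open>Closed forms of convolutions of divisor sums\<close>

definition divisor_conv :: "nat \<Rightarrow> nat \<Rightarrow> nat \<Rightarrow> nat" where
  "divisor_conv i j n = (\<Sum>m\<in>{1..<n}. divisor_sum i m * divisor_sum j (n - m))"

lemma divisor_conv_commute: "divisor_conv i j n = divisor_conv j i n"
  unfolding divisor_conv_def
  by (rule sum.reindex_bij_witness[where i = "\<lambda>m. n - m" and j = "\<lambda>m. n - m"]) auto

text \<open>Group by \<open>m = a * x\<close>: then \<open>a\<close> and \<open>b\<close> run
  independently over the divisors of \<open>m\<close> and \<open>n - m\<close>, and determine
  \<open>x\<close> and \<open>y\<close>.\<close>

lemma sum_two_term_reps:
  assumes "0 < n"
  shows "(\<Sum>(a, b, x, y)\<in>two_term_reps n. of_nat a ^ i * of_nat b ^ j)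
    = (of_nat (divisor_conv i j n) :: 'a :: comm_semiring_1)"
proof -
  have split: "n = m + z \<and> 0 < z" if "n - m = z" "m < n" for m z
    using that by auto
  have "divisor_conv i j n = (\<Sum>m\<in>{1..<n}. \<Sum>(a, b)\<in>{a. a dvd m} \<times> {b. b dvd n - m}. a ^ i * b ^ j)"
    by (simp add: divisor_conv_def divisor_sum_def sum_product sum.cartesian_product)
  also have "\<dots> = (\<Sum>(m, a, b)\<in>(SIGMA m:{1..<n}. {a. a dvd m} \<times> {b. b dvd n - m}). a ^ i * b ^ j)"
    by (subst sum.Sigma) (auto simp: case_prod_beta)
  also have "\<dots> = (\<Sum>(a, b, x, y)\<in>two_term_reps n. a ^ i * b ^ j)"
    by (rule sum.reindex_bij_witness[where
          j = "\<lambda>(m, a, b). (a, b, m div a, (n - m) div b)"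
          and i = "\<lambda>(a, b, x, y). (a * x, a, b)"])
      (auto simp: two_term_reps_def elim!: dvdE dest!: split)
  finally show ?thesis by (simp add: case_prod_beta)
qed

text \<open>Faulhaber's formulas with the upper limit excluded, which makes the second term of each
  polynomial negative.\<close>

lemma sum_powers:
  fixes d :: nat
  assumes "1 \<le> d"
  shows "(\<Sum>a\<in>{1..<d}. (of_nat a :: 'a :: field_char_0)) = (of_nat d ^ 2 - of_nat d) / 2"
    and "(\<Sum>a\<in>{1..<d}. (of_nat a :: 'a) ^ 2) = (2 * of_nat d ^ 3 - 3 * of_nat d ^ 2 + of_nat d) / 6"
    and "(\<Sum>a\<in>{1..<d}. (of_nat a :: 'a) ^ 3) = (of_nat d ^ 4 - 2 * of_nat d ^ 3 + of_nat d ^ 2) / 4"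
    and "(\<Sum>a\<in>{1..<d}. (of_nat a :: 'a) ^ 4)
      = (6 * of_nat d ^ 5 - 15 * of_nat d ^ 4 + 10 * of_nat d ^ 3 - of_nat d) / 30"
    and "(\<Sum>a\<in>{1..<d}. (of_nat a :: 'a) ^ 5)
      = (2 * of_nat d ^ 6 - 6 * of_nat d ^ 5 + 5 * of_nat d ^ 4 - of_nat d ^ 2) / 12"
    and "(\<Sum>a\<in>{1..<d}. (of_nat a :: 'a) ^ 6)
      = (6 * of_nat d ^ 7 - 21 * of_nat d ^ 6 + 21 * of_nat d ^ 5 - 7 * of_nat d ^ 3
          + of_nat d) / 42"
  using assms
  by (induction d rule: nat_induct_at_least; simp add: field_simps; algebra)+

lemma sum_divisors_quotient:
  assumes "0 < n"
  shows "(\<Sum>d | d dvd n. (of_nat (n div d) - 1) * of_nat d ^ Suc k)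
    = (of_nat n * of_nat (divisor_sum k n) - of_nat (divisor_sum (Suc k) n) :: 'a :: comm_ring_1)"
proof -
  have "(of_nat (n div d) - 1) * of_nat d ^ Suc k
      = (of_nat n * of_nat (d ^ k) - of_nat (d ^ Suc k) :: 'a)" if "d dvd n" for d
  proof -
    have "of_nat (n div d) * of_nat d = (of_nat n :: 'a)"
      using that by (simp flip: of_nat_mult)
    then show ?thesis by (simp add: algebra_simps) (metis mult.assoc mult.commute)
  qed
  then have "(\<Sum>d | d dvd n. (of_nat (n div d) - 1) * of_nat d ^ Suc k)
      = (\<Sum>d | d dvd n. (of_nat n * of_nat (d ^ k) - of_nat (d ^ Suc k) :: 'a))"
    by (intro sum.cong) auto
  then show ?thesis
    by (simp add: divisor_sum_def sum_subtractf sum_distrib_left)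
qed

lemma of_nat_divisor_sum: "of_nat (divisor_sum k n) = (\<Sum>d | d dvd n. of_nat d ^ k)"
  by (simp add: divisor_sum_def)

text \<open>Interface for polynomial \<open>h\<close>: \<open>g\<close> is the difference
  polynomial, \<open>e * x ^ Suc k\<close> the restriction to the axis, \<open>H\<close> the
  restriction to the line of sum \<open>c\<close>, and \<open>G\<close> the resulting power sum.
  Each application then reduces to polynomial identities.\<close>

lemma liouville_identity_divisor_sums:
  fixes h :: "complex \<Rightarrow> complex \<Rightarrow> complex"
  assumes n: "0 < n"
    and "\<And>x y. h x y = h y x" and "\<And>x y. h x y = h (x + y) (- y)"
    and diff: "\<And>x y. h x y - h x (y - x) = g x y"
    and diag: "\<And>x. h x 0 = e * x ^ Suc k"
    and inner: "\<And>x c. h x (c - x) = H c x"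
    and H: "\<And>d. 1 \<le> d \<Longrightarrow> (\<Sum>a\<in>{1..<d}. H (of_nat d) (of_nat a)) = G d"
  shows "(\<Sum>(a, b, x, y)\<in>two_term_reps n. g (of_nat a) (of_nat b))
      + e * (of_nat n * of_nat (divisor_sum k n) - of_nat (divisor_sum (Suc k) n))
    = (\<Sum>d | d dvd n. G d)"
proof -
  have "(\<Sum>(a, b, x, y)\<in>two_term_reps n.
            h (of_nat a) (of_nat b) - h (of_nat a) (of_nat b - of_nat a))
         + (\<Sum>d | d dvd n. (of_nat (n div d) - 1) * h (of_nat d) 0)
       = (\<Sum>d | d dvd n. \<Sum>a\<in>{1..<d}. h (of_nat a) (of_nat d - of_nat a))"
    by (rule liouville_identity) fact+
  moreover have "(\<Sum>d | d dvd n. (of_nat (n div d) - 1) * h (of_nat d) 0)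
      = e * (\<Sum>d | d dvd n. (of_nat (n div d) - 1) * of_nat d ^ Suc k)"
    by (simp add: diag sum_distrib_left mult_ac)
  moreover have "(\<Sum>d | d dvd n. \<Sum>a\<in>{1..<d}. h (of_nat a) (of_nat d - of_nat a))
      = (\<Sum>d | d dvd n. G d)"
  proof (rule sum.cong[OF refl])
    fix d assume "d \<in> {d. d dvd n}"
    then have "1 \<le> d" using n by (cases d) auto
    then show "(\<Sum>a\<in>{1..<d}. h (of_nat a) (of_nat d - of_nat a)) = G d"
      using H[of d] by (simp add: inner)
  qed
  ultimately show ?thesis
    by (simp only: diff sum_divisors_quotient[OF n])
qed

text \<open>Take \<open>h = x^2 + x y + y^2\<close>, whose difference is \<open>2 x y\<close>. The
  terms in \<open>divisor_sum 2 n\<close> from the diagonal \<open>a = b\<close> and from the power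
  sums cancel.\<close>

lemma divisor_conv_1_1:
  assumes n: "0 < n"
  shows "12 * of_nat (divisor_conv 1 1 n) = (5 * of_nat (divisor_sum 3 n)
      + of_nat (divisor_sum 1 n) - 6 * of_nat n * of_nat (divisor_sum 1 n) :: complex)"
proof -
  have L: "(\<Sum>(a, b, x, y)\<in>two_term_reps n. 2 * (of_nat a ^ 1 * of_nat b ^ 1))
      + 1 * (of_nat n * of_nat (divisor_sum 1 n) - of_nat (divisor_sum (Suc 1) n))
    = (\<Sum>d | d dvd n. ((5 * of_nat d ^ 3 - 6 * of_nat d ^ 2 + of_nat d ^ 1) / 6 :: complex))"
  proof (rule liouville_identity_divisor_sums[OF n, where h = "\<lambda>x y. x ^ 2 + x * y + y ^ 2"
        and g = "\<lambda>x y. 2 * (x ^ 1 * y ^ 1)" and H = "\<lambda>c x. x ^ 2 - c * x + c ^ 2"])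
    fix d :: nat assume d: "1 \<le> d"
    then show "(\<Sum>x\<in>{1..<d}. of_nat x ^ 2 - of_nat d * of_nat x + of_nat d ^ 2)
        = ((5 * of_nat d ^ 3 - 6 * of_nat d ^ 2 + of_nat d ^ 1) / 6 :: complex)"
      by (simp only: sum.distrib sum_subtractf sum_powers[OF d] sum_distrib_left[symmetric]
          sum_constant card_atLeastLessThan of_nat_diff of_nat_1)
        (simp add: field_simps, algebra)
  qed (algebra | simp add: power_mult[symmetric] eval_nat_numeral)+
  have G: "(\<Sum>d | d dvd n. ((5 * of_nat d ^ 3 - 6 * of_nat d ^ 2 + of_nat d ^ 1) / 6 :: complex))
      = (5 * of_nat (divisor_sum 3 n) - 6 * of_nat (divisor_sum 2 n)
      + of_nat (divisor_sum 1 n)) / 6"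
    by (simp only: of_nat_divisor_sum sum.distrib sum_subtractf sum_distrib_left[symmetric]
        sum_divide_distrib[symmetric])
  have S: "(\<Sum>(a, b, x, y)\<in>two_term_reps n. 2 * (of_nat a ^ 1 * of_nat b ^ 1))
      = (2 * of_nat (divisor_conv 1 1 n) :: complex)"
    by (simp only: case_prod_beta' sum.distrib sum_distrib_left[symmetric]
        sum_two_term_reps[OF n, unfolded case_prod_beta'] divisor_conv_commute)
  show ?thesis
    using L unfolding G S by (simp add: field_simps numeral_2_eq_2)
qed

text \<open>Take the square of \<open>x^2 + x y + y^2\<close>. Its difference contains both
  \<open>x y^3\<close> and \<open>x^3 y\<close>, which contribute equally by symmetry; the terms in
  \<open>divisor_sum 4 n\<close> cancel.\<close>

lemma divisor_conv_1_3:
  assumes n: "0 < n"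
  shows "240 * of_nat (divisor_conv 1 3 n) = (21 * of_nat (divisor_sum 5 n)
      + 10 * of_nat (divisor_sum 3 n) - of_nat (divisor_sum 1 n)
      - 30 * of_nat n * of_nat (divisor_sum 3 n) :: complex)"
proof -
  have L: "(\<Sum>(a, b, x, y)\<in>two_term_reps n. 4 * (of_nat a ^ 1 * of_nat b ^ 3)
      + 4 * (of_nat a ^ 3 * of_nat b ^ 1))
      + 1 * (of_nat n * of_nat (divisor_sum 3 n) - of_nat (divisor_sum (Suc 3) n))
    = (\<Sum>d | d dvd n. ((21 * of_nat d ^ 5 - 30 * of_nat d ^ 4 + 10 * of_nat d ^ 3
        - of_nat d ^ 1) / 30 :: complex))"
  proof (rule liouville_identity_divisor_sums[OF n, where h = "\<lambda>x y. (x ^ 2 + x * y + y ^ 2) ^ 2"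
        and g = "\<lambda>x y. 4 * (x ^ 1 * y ^ 3) + 4 * (x ^ 3 * y ^ 1)"
        and H = "\<lambda>c x. x ^ 4 - 2 * c * x ^ 3 + 3 * c ^ 2 * x ^ 2 - 2 * c ^ 3 * x + c ^ 4"])
    fix d :: nat assume d: "1 \<le> d"
    then show "(\<Sum>x\<in>{1..<d}. of_nat x ^ 4 - 2 * of_nat d * of_nat x ^ 3
        + 3 * of_nat d ^ 2 * of_nat x ^ 2 - 2 * of_nat d ^ 3 * of_nat x + of_nat d ^ 4)
        = ((21 * of_nat d ^ 5 - 30 * of_nat d ^ 4 + 10 * of_nat d ^ 3 - of_nat d ^ 1) / 30
        :: complex)"
      by (simp only: sum.distrib sum_subtractf sum_powers[OF d] sum_distrib_left[symmetric]
          sum_constant card_atLeastLessThan of_nat_diff of_nat_1)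
        (simp add: field_simps, algebra)
  qed (algebra | simp add: power_mult[symmetric] eval_nat_numeral)+
  have G: "(\<Sum>d | d dvd n. ((21 * of_nat d ^ 5 - 30 * of_nat d ^ 4 + 10 * of_nat d ^ 3
      - of_nat d ^ 1) / 30 :: complex)) = (21 * of_nat (divisor_sum 5 n)
      - 30 * of_nat (divisor_sum 4 n) + 10 * of_nat (divisor_sum 3 n)
      - of_nat (divisor_sum 1 n)) / 30"
    by (simp only: of_nat_divisor_sum sum.distrib sum_subtractf sum_distrib_left[symmetric]
        sum_divide_distrib[symmetric])
  have S: "(\<Sum>(a, b, x, y)\<in>two_term_reps n. 4 * (of_nat a ^ 1 * of_nat b ^ 3)
      + 4 * (of_nat a ^ 3 * of_nat b ^ 1)) = (4 * of_nat (divisor_conv 1 3 n)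
      + 4 * of_nat (divisor_conv 3 1 n) :: complex)"
    by (simp only: case_prod_beta' sum.distrib sum_distrib_left[symmetric]
        sum_two_term_reps[OF n, unfolded case_prod_beta'] divisor_conv_commute)
  show ?thesis
    using L unfolding G S divisor_conv_commute[of 3 1] by (simp add: field_simps)
qed

text \<open>Take \<open>h = (x y (x + y))^2\<close>, for which the difference is the single monomial
  \<open>4 x^3 y^3\<close>.\<close>

lemma divisor_conv_3_3:
  assumes n: "0 < n"
  shows "120 * of_nat (divisor_conv 3 3 n) = (of_nat (divisor_sum 7 n) - of_nat (divisor_sum 3 n)
      :: complex)"
proof -
  have L: "(\<Sum>(a, b, x, y)\<in>two_term_reps n. 4 * (of_nat a ^ 3 * of_nat b ^ 3))
      + 0 * (of_nat n * of_nat (divisor_sum 1 n) - of_nat (divisor_sum (Suc 1) n))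
    = (\<Sum>d | d dvd n. ((of_nat d ^ 7 - of_nat d ^ 3) / 30 :: complex))"
  proof (rule liouville_identity_divisor_sums[OF n, where h = "\<lambda>x y. (x * y * (x + y)) ^ 2"
        and g = "\<lambda>x y. 4 * (x ^ 3 * y ^ 3)"
        and H = "\<lambda>c x. c ^ 2 * x ^ 4 - 2 * c ^ 3 * x ^ 3 + c ^ 4 * x ^ 2"])
    fix d :: nat assume d: "1 \<le> d"
    then show "(\<Sum>x\<in>{1..<d}. of_nat d ^ 2 * of_nat x ^ 4 - 2 * of_nat d ^ 3 * of_nat x ^ 3
        + of_nat d ^ 4 * of_nat x ^ 2) = ((of_nat d ^ 7 - of_nat d ^ 3) / 30 :: complex)"
      by (simp only: sum.distrib sum_subtractf sum_powers[OF d] sum_distrib_left[symmetric]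
          sum_constant card_atLeastLessThan of_nat_diff of_nat_1)
        (simp add: field_simps, algebra)
  qed (algebra | simp add: power_mult[symmetric] eval_nat_numeral)+
  have G: "(\<Sum>d | d dvd n. ((of_nat d ^ 7 - of_nat d ^ 3) / 30 :: complex))
      = (of_nat (divisor_sum 7 n) - of_nat (divisor_sum 3 n)) / 30"
    by (simp only: of_nat_divisor_sum sum.distrib sum_subtractf sum_distrib_left[symmetric]
        sum_divide_distrib[symmetric])
  have S: "(\<Sum>(a, b, x, y)\<in>two_term_reps n. 4 * (of_nat a ^ 3 * of_nat b ^ 3))
      = (4 * of_nat (divisor_conv 3 3 n) :: complex)"
    by (simp only: case_prod_beta' sum.distrib sum_distrib_left[symmetric]
        sum_two_term_reps[OF n, unfolded case_prod_beta'] divisor_conv_commute)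
  show ?thesis
    using L unfolding G S by (simp add: field_simps)
qed

text \<open>Take the cube of \<open>x^2 + x y + y^2\<close>. The extra monomial
  \<open>14 x^3 y^3\<close> in the difference is evaluated by \<open>divisor_conv_3_3\<close>; the
  terms in \<open>divisor_sum 6 n\<close> cancel.\<close>

lemma divisor_conv_1_5:
  assumes n: "0 < n"
  shows "504 * of_nat (divisor_conv 1 5 n) = (20 * of_nat (divisor_sum 7 n)
      + 21 * of_nat (divisor_sum 5 n) + of_nat (divisor_sum 1 n)
      - 42 * of_nat n * of_nat (divisor_sum 5 n) :: complex)"
proof -
  have L: "(\<Sum>(a, b, x, y)\<in>two_term_reps n. 6 * (of_nat a ^ 1 * of_nat b ^ 5)
      + 6 * (of_nat a ^ 5 * of_nat b ^ 1) + 14 * (of_nat a ^ 3 * of_nat b ^ 3))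
      + 1 * (of_nat n * of_nat (divisor_sum 5 n) - of_nat (divisor_sum (Suc 5) n))
    = (\<Sum>d | d dvd n. ((249 * of_nat d ^ 7 - 420 * of_nat d ^ 6 + 210 * of_nat d ^ 5
        - 49 * of_nat d ^ 3 + 10 * of_nat d ^ 1) / 420 :: complex))"
  proof (rule liouville_identity_divisor_sums[OF n, where h = "\<lambda>x y. (x ^ 2 + x * y + y ^ 2) ^ 3"
        and g = "\<lambda>x y. 6 * (x ^ 1 * y ^ 5) + 6 * (x ^ 5 * y ^ 1) + 14 * (x ^ 3 * y ^ 3)"
        and H = "\<lambda>c x. x ^ 6 - 3 * c * x ^ 5 + 6 * c ^ 2 * x ^ 4 - 7 * c ^ 3 * x ^ 3
            + 6 * c ^ 4 * x ^ 2 - 3 * c ^ 5 * x + c ^ 6"])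
    fix d :: nat assume d: "1 \<le> d"
    then show "(\<Sum>x\<in>{1..<d}. of_nat x ^ 6 - 3 * of_nat d * of_nat x ^ 5
        + 6 * of_nat d ^ 2 * of_nat x ^ 4 - 7 * of_nat d ^ 3 * of_nat x ^ 3
        + 6 * of_nat d ^ 4 * of_nat x ^ 2 - 3 * of_nat d ^ 5 * of_nat x + of_nat d ^ 6)
        = ((249 * of_nat d ^ 7 - 420 * of_nat d ^ 6 + 210 * of_nat d ^ 5 - 49 * of_nat d ^ 3
        + 10 * of_nat d ^ 1) / 420 :: complex)"
      by (simp only: sum.distrib sum_subtractf sum_powers[OF d] sum_distrib_left[symmetric]
          sum_constant card_atLeastLessThan of_nat_diff of_nat_1)
        (simp add: field_simps, algebra)
  qed (algebra | simp add: power_mult[symmetric] eval_nat_numeral)+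
  have G: "(\<Sum>d | d dvd n. ((249 * of_nat d ^ 7 - 420 * of_nat d ^ 6 + 210 * of_nat d ^ 5
      - 49 * of_nat d ^ 3 + 10 * of_nat d ^ 1) / 420 :: complex))
      = (249 * of_nat (divisor_sum 7 n) - 420 * of_nat (divisor_sum 6 n)
      + 210 * of_nat (divisor_sum 5 n) - 49 * of_nat (divisor_sum 3 n)
      + 10 * of_nat (divisor_sum 1 n)) / 420"
    by (simp only: of_nat_divisor_sum sum.distrib sum_subtractf sum_distrib_left[symmetric]
        sum_divide_distrib[symmetric])
  have S: "(\<Sum>(a, b, x, y)\<in>two_term_reps n. 6 * (of_nat a ^ 1 * of_nat b ^ 5)
      + 6 * (of_nat a ^ 5 * of_nat b ^ 1) + 14 * (of_nat a ^ 3 * of_nat b ^ 3))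
      = (6 * of_nat (divisor_conv 1 5 n) + 6 * of_nat (divisor_conv 5 1 n)
      + 14 * of_nat (divisor_conv 3 3 n) :: complex)"
    by (simp only: case_prod_beta' sum.distrib sum_distrib_left[symmetric]
        sum_two_term_reps[OF n, unfolded case_prod_beta'] divisor_conv_commute)
  show ?thesis
    using L divisor_conv_3_3[OF n] unfolding G S divisor_conv_commute[of 5 1]
    by (simp add: field_simps) algebra
qed

section \<open>Ramanujan's differential equations\<close>

text \<open>A common shape for the three Eisenstein series, so that one formula gives the
  coefficients of all their products.\<close>

definition eisenstein_fps :: "nat \<Rightarrow> complex \<Rightarrow> complex fps" where
  "eisenstein_fps k c = Abs_fps (\<lambda>n. if n = 0 then 1 else c * of_nat (divisor_sum k n))"

lemma E2_eisenstein: "E2 = eisenstein_fps 1 (- 24)"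
  and E4_eisenstein: "E4 = eisenstein_fps 3 240"
  and E6_eisenstein: "E6 = eisenstein_fps 5 (- 504)"
  by (simp_all add: E2_def E4_def E6_def eisenstein_fps_def del: One_nat_def)

lemma eisenstein_fps_nth:
  "eisenstein_fps k c $ n = (if n = 0 then 1 else c * of_nat (divisor_sum k n))"
  by (simp add: eisenstein_fps_def)

lemma eisenstein_fps_mult_nth:
  assumes "0 < n"
  shows "(eisenstein_fps i c * eisenstein_fps j d) $ n
    = c * of_nat (divisor_sum i n) + d * of_nat (divisor_sum j n)
        + c * d * of_nat (divisor_conv i j n)"
proof -
  have "{0..n} = insert 0 (insert n {1..<n})" using assms by auto
  then show ?thesis
    using assms by (simp add: fps_mult_nth eisenstein_fps_nth divisor_conv_def sum_distrib_left mult_ac)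
qed

definition q_deriv :: "'a :: comm_semiring_1 fps \<Rightarrow> 'a fps" where
  "q_deriv f = fps_X * fps_deriv f"

lemma q_deriv_nth [simp]: "q_deriv f $ n = of_nat n * f $ n"
  by (cases n) (simp_all add: q_deriv_def)

lemma q_deriv_add: "q_deriv (f + g) = q_deriv f + q_deriv g"
  and q_deriv_mult: "q_deriv (f * g) = f * q_deriv g + q_deriv f * g"
  and q_deriv_const: "q_deriv (fps_const c) = 0"
  by (simp_all add: q_deriv_def algebra_simps)

lemma q_deriv_diff: "q_deriv (f - g) = q_deriv f - q_deriv (g :: 'a :: comm_ring_1 fps)"
  by (simp add: q_deriv_def algebra_simps)

lemma ramanujan_E2: "12 * q_deriv E2 = E2\<^sup>2 - E4"
proof (rule fps_ext)
  fix n show "(12 * q_deriv E2) $ n = (E2\<^sup>2 - E4) $ n"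
  proof (cases "n = 0")
    case False
    then show ?thesis
      using divisor_conv_1_1[of n]
      by (simp add: numeral_fps_const power2_eq_square E2_eisenstein E4_eisenstein
          eisenstein_fps_nth eisenstein_fps_mult_nth) algebra
  qed (simp add: power2_eq_square E2_eisenstein E4_eisenstein eisenstein_fps_nth)
qed

lemma ramanujan_E4: "3 * q_deriv E4 = E2 * E4 - E6"
proof (rule fps_ext)
  fix n show "(3 * q_deriv E4) $ n = (E2 * E4 - E6) $ n"
  proof (cases "n = 0")
    case False
    then show ?thesis
      using divisor_conv_1_3[of n]
      by (simp add: numeral_fps_const E2_eisenstein E4_eisenstein E6_eisenstein
          eisenstein_fps_nth eisenstein_fps_mult_nth) algebra
  qed (simp add: E2_eisenstein E4_eisenstein E6_eisenstein eisenstein_fps_nth)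
qed

text \<open>Both \<open>E2 * E6\<close> and \<open>E4\<^sup>2\<close> contribute
  \<open>480 * divisor_sum 7 n\<close> to the \<open>n\<close>-th coefficient, and these
  cancel.\<close>

lemma ramanujan_E6: "2 * q_deriv E6 = E2 * E6 - E4\<^sup>2"
proof (rule fps_ext)
  fix n show "(2 * q_deriv E6) $ n = (E2 * E6 - E4\<^sup>2) $ n"
  proof (cases "n = 0")
    case False
    then show ?thesis
      using divisor_conv_1_5[of n] divisor_conv_3_3[of n]
      by (simp add: numeral_fps_const power2_eq_square E2_eisenstein E4_eisenstein E6_eisenstein
          eisenstein_fps_nth eisenstein_fps_mult_nth) algebra
  qed (simp add: power2_eq_square E2_eisenstein E4_eisenstein E6_eisenstein eisenstein_fps_nth)
qed

section \<open>The recursive family\<close>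

definition delta_fps :: "complex fps" where
  "delta_fps = fps_const (1 / 1728) * (E4 ^ 3 - E6 ^ 2)"

lemma delta_fps_eq: "1728 * delta_fps = E4 ^ 3 - E6 ^ 2"
  by (simp add: delta_fps_def numeral_fps_const flip: mult.assoc)

text \<open>In the derivative of \<open>E4 ^ 3 - E6 ^ 2\<close> the mixed terms
  \<open>E4\<^sup>2 * E6\<close> cancel. The factor 6 clears the coefficients 3 and 2 of Ramanujan's
  equations.\<close>

lemma q_deriv_delta_fps: "q_deriv delta_fps = E2 * delta_fps"
proof -
  have "6 * q_deriv (1728 * delta_fps) = 6 * E2 * (1728 * delta_fps)"
    unfolding delta_fps_eq power2_eq_square power3_eq_cube q_deriv_diff q_deriv_mult
    using ramanujan_E4 ramanujan_E6 by algebra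
  then have "10368 * q_deriv delta_fps = 10368 * (E2 * delta_fps)"
    by (simp add: numeral_fps_const q_deriv_mult q_deriv_const flip: mult.assoc)
  then show ?thesis by simp
qed

fun extremal_rec :: "nat \<Rightarrow> complex fps" where
  "extremal_rec 0 = 1"
| "extremal_rec (Suc 0) = fps_const (1 / 720) * (E2 * E4 - E6)"
| "extremal_rec (Suc (Suc n)) =
     fps_const (of_nat ((n + 1) * (n + 2)) / of_nat (12 * (6 * n + 7) * (6 * n + 11)))
     * (delta_fps * extremal_rec n - E6 * extremal_rec (Suc n))"

lemma extremal_rec_1: "720 * extremal_rec (Suc 0) = E2 * E4 - E6"
  by (simp add: numeral_fps_const flip: mult.assoc)

text \<open>The recursion without denominators, its scalars being power series, so that it can enter
  ring computations directly.\<close>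

lemma extremal_rec_Suc_Suc:
  "12 * (6 * of_nat n + 7) * (6 * of_nat n + 11) * extremal_rec (Suc (Suc n))
    = (of_nat n + 1) * (of_nat n + 2) * (delta_fps * extremal_rec n - E6 * extremal_rec (Suc n))"
proof -
  define N :: nat where "N = 12 * (6 * n + 7) * (6 * n + 11)"
  have "N \<noteq> 0" by (simp add: N_def)
  then have "of_nat N * (fps_const (c / of_nat N) * g) = fps_const c * g" for c :: complex and g
    by (simp flip: fps_of_nat mult.assoc)
  then have "of_nat N * extremal_rec (Suc (Suc n))
    = of_nat ((n + 1) * (n + 2)) * (delta_fps * extremal_rec n - E6 * extremal_rec (Suc n))"
    by (simp only: extremal_rec.simps N_def[symmetric] fps_of_nat)
  then show ?thesis
    by (simp only: N_def of_nat_mult of_nat_add of_nat_numeral of_nat_1)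
qed

declare extremal_rec.simps(2,3) [simp del]

text \<open>The first equation at \<open>n\<close> and the recursion give the second at
  \<open>n + 1\<close>. Differentiating the recursion and eliminating all derivatives by the two
  equations at \<open>n\<close> gives the first at \<open>n + 1\<close>.\<close>

lemma extremal_rec_system:
  "12 * E4 * q_deriv (extremal_rec (Suc n)) - (6 * of_nat n + 5) * E2 * E4 * extremal_rec (Suc n)
     = - (6 * of_nat n + 5) * E6 * extremal_rec (Suc n) + 12 * (of_nat n
         + 1) * delta_fps * extremal_rec n
   \<and> (of_nat n + 1) * (12 * E4 * q_deriv (extremal_rec n) - (6 * of_nat n
       - 1) * E2 * E4 * extremal_rec n
        - (6 * of_nat n + 1) * E6 * extremal_rec n)
     = 144 * (6 * of_nat n + 1) * (6 * of_nat n + 5) * extremal_rec (Suc n)"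
proof (induction n)
  case 0
  have "720 * q_deriv (extremal_rec (Suc 0)) = q_deriv (E2 * E4 - E6)"
    by (simp add: numeral_fps_const q_deriv_mult q_deriv_const flip: extremal_rec_1)
  also have "\<dots> = E2 * q_deriv E4 + q_deriv E2 * E4 - q_deriv E6"
    by (simp add: q_deriv_diff q_deriv_mult)
  finally have "720 * q_deriv (extremal_rec (Suc 0)) = \<dots>" .
  then have "720 * (12 * E4 * q_deriv (extremal_rec (Suc 0)) - 5 * E2 * E4 * extremal_rec (Suc 0))
     = 720 * (- 5 * E6 * extremal_rec (Suc 0) + 12 * delta_fps)"
    using ramanujan_E2 ramanujan_E4 ramanujan_E6 delta_fps_eq extremal_rec_1 by algebra
  then have "12 * E4 * q_deriv (extremal_rec (Suc 0)) - 5 * E2 * E4 * extremal_rec (Suc 0)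
     = - 5 * E6 * extremal_rec (Suc 0) + 12 * delta_fps"
    by (subst (asm) mult_left_cancel) auto
  moreover have "q_deriv 1 = (0 :: complex fps)"
    using q_deriv_const[of 1] by simp
  ultimately show ?case
    using extremal_rec_1 by simp
next
  case (Suc n)
  define f0 f1 f2 where f: "f0 = extremal_rec n" "f1 = extremal_rec (Suc n)" "f2
      = extremal_rec (Suc (Suc n))"
  define m :: "complex fps" where "m = of_nat n"
  have pos: "m + 1 \<noteq> 0" "m + 2 \<noteq> 0" "6 * m + 7 \<noteq> 0" "6 * m + 11 \<noteq> 0"
  proof -
    have "m + 1 = of_nat (n + 1)" "m + 2 = of_nat (n + 2)"
      "6 * m + 7 = of_nat (6 * n + 7)" "6 * m + 11 = of_nat (6 * n + 11)"
      by (simp_all add: m_def)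
    then show "m + 1 \<noteq> 0" "m + 2 \<noteq> 0" "6 * m + 7 \<noteq> 0" "6 * m + 11 \<noteq> 0"
      by (simp_all only: of_nat_eq_0_iff)
  qed
  have I: "12 * E4 * q_deriv f1 - (6 * m + 5) * E2 * E4 * f1
      = - (6 * m + 5) * E6 * f1 + 12 * (m + 1) * delta_fps * f0"
    and II: "(m + 1) * (12 * E4 * q_deriv f0 - (6 * m - 1) * E2 * E4 * f0 - (6 * m + 1) * E6 * f0)
      = 144 * (6 * m + 1) * (6 * m + 5) * f1"
    using Suc unfolding f m_def by simp_all
  have rec: "12 * (6 * m + 7) * (6 * m + 11) * f2 = (m + 1) * (m + 2) * (delta_fps * f0 - E6 * f1)"
    using extremal_rec_Suc_Suc[of n] unfolding f m_def .
  have "q_deriv (12 * (6 * m + 7) * (6 * m + 11) * f2)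
      = 12 * (6 * m + 7) * (6 * m + 11) * q_deriv f2"
    by (simp add: m_def q_deriv_mult q_deriv_add q_deriv_const numeral_fps_const flip: fps_of_nat)
  moreover have "q_deriv ((m + 1) * (m + 2) * (delta_fps * f0 - E6 * f1))
    = (m + 1) * (m + 2) * (E2 * delta_fps * f0 + delta_fps * q_deriv f0 - q_deriv E6 * f1
        - E6 * q_deriv f1)"
    by (simp add: m_def q_deriv_mult q_deriv_add q_deriv_diff q_deriv_const q_deriv_delta_fps numeral_fps_const algebra_simps flip: fps_of_nat fps_const_1_eq_1)
  ultimately have drec: "12 * (6 * m + 7) * (6 * m + 11) * q_deriv f2 =
     (m + 1) * (m + 2) * (E2 * delta_fps * f0 + delta_fps * q_deriv f0 - q_deriv E6 * f1
         - E6 * q_deriv f1)"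
    using rec by simp
  have "(m + 1) * ((m + 2) * (12 * E4 * q_deriv f1 - (6 * m + 5) * E2 * E4 * f1 - (6 * m
      + 7) * E6 * f1))
     = (m + 1) * (144 * (6 * m + 7) * (6 * m + 11) * f2)"
    using I rec by algebra
  then have II': "(m + 2) * (12 * E4 * q_deriv f1 - (6 * m + 5) * E2 * E4 * f1 - (6 * m
      + 7) * E6 * f1)
     = 144 * (6 * m + 7) * (6 * m + 11) * f2" using pos by simp
  define K where "K = 12 * (6 * m + 7) * (6 * m + 11)"
  have d0: "(m + 1) * (12 * E4 * q_deriv f0) = (m + 1) * ((6 * m - 1) * E2 * E4 * f0
      + (6 * m + 1) * E6 * f0) + 144 * (6 * m + 1) * (6 * m + 5) * f1"
    using II by algebra
  have d1: "12 * E4 * q_deriv f1 = (6 * m + 5) * E2 * E4 * f1 - (6 * m + 5) * E6 * f1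
      + 12 * (m + 1) * delta_fps * f0"
    using I by algebra
  \<comment> \<open>\<open>E4 ^ 3\<close> is replaced by
    \<open>E6 ^ 2 + 1728 * delta_fps\<close>.\<close>
  have d6: "12 * E4 * q_deriv E6 = 6 * E2 * E4 * E6 - 6 * E6 ^ 2 - 10368 * delta_fps"
    using ramanujan_E6 delta_fps_eq by algebra
  have "K * (12 * E4 * q_deriv f2 - (6 * m + 11) * E2 * E4 * f2)
      = 12 * E4 * (K * q_deriv f2) - (6 * m + 11) * E2 * E4 * (K * f2)"
    by algebra
  \<comment> \<open>Grouped so that the left sides of \<open>d0\<close>, \<open>d1\<close> and
    \<open>d6\<close> occur literally. The factor \<open>m + 1\<close> stays with the derivative of
    \<open>f0\<close> because \<open>II\<close> determines only that product.\<close>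
  also have "\<dots> = (m + 2) * (delta_fps * ((m + 1) * (12 * E4 * q_deriv f0))
      + (m + 1) * ((1 - 6 * m) * E2 * E4 * delta_fps * f0 - (12 * E4 * q_deriv E6) * f1
        - E6 * (12 * E4 * q_deriv f1) + (6 * m + 11) * E2 * E4 * E6 * f1))"
    unfolding K_def drec rec by algebra
  also have "\<dots> = - (6 * m + 11) * E6 * (K * f2) + 12 * (m + 2) * delta_fps * (K * f1)"
    unfolding d0 d1 d6 unfolding K_def rec by algebra
  also have "\<dots> = K * (- (6 * m + 11) * E6 * f2 + 12 * (m + 2) * delta_fps * f1)"
    by algebra
  finally have "K * (12 * E4 * q_deriv f2 - (6 * m + 11) * E2 * E4 * f2) = \<dots>" .
  moreover have "K \<noteq> 0"
    unfolding K_def using pos by (simp only: mult_eq_0_iff) simp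
  ultimately have I': "12 * E4 * q_deriv f2 - (6 * m + 11) * E2 * E4 * f2
    = - (6 * m + 11) * E6 * f2 + 12 * (m + 2) * delta_fps * f1"
    by (simp only: mult_cancel_left) simp
  show ?case
    using I' II' unfolding f m_def by (simp add: algebra_simps)
qed

section \<open>The first two coefficients of the recursive family\<close>

lemma fps_mult_nth_vanishing:
  fixes f g :: "'a :: semiring_1 fps"
  assumes "\<And>i. i < n \<Longrightarrow> g $ i = 0"
  shows "(f * g) $ (n + j) = (\<Sum>i=0..j. f $ i * g $ (n + j - i))"
  unfolding fps_mult_nth using assms by (intro sum.mono_neutral_right) auto

lemma divisor_sum_1: "divisor_sum k (Suc 0) = 1"
  by (simp add: divisor_sum_def)

lemma divisor_sum_2: "divisor_sum k 2 = 1 + 2 ^ k"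
proof -
  have "{d :: nat. d dvd 2} = {1, 2}"
    using prime_nat_iff[of 2] by auto
  then show ?thesis by (simp add: divisor_sum_def)
qed

lemma eisenstein_nth_small:
  "E2 $ 0 = 1" "E2 $ Suc 0 = - 24"
  "E4 $ 0 = 1" "E4 $ Suc 0 = 240" "E4 $ 2 = 2160"
  "E6 $ 0 = 1" "E6 $ Suc 0 = - 504" "E6 $ 2 = - 16632"
  by (simp_all add: E2_def E4_def E6_def divisor_sum_1 divisor_sum_2)

lemma delta_fps_nth_small: "delta_fps $ 0 = 0" "delta_fps $ Suc 0 = 1" "delta_fps $ 2 = - 24"
  by (simp_all add: delta_fps_def power2_eq_square power3_eq_cube fps_mult_nth
      eisenstein_nth_small[unfolded numeral_2_eq_2] numeral_2_eq_2)

lemma extremal_rec_1_eq: "extremal_rec (Suc 0) = fps_const (1 / 240) * q_deriv E4"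
proof -
  have "720 * extremal_rec (Suc 0) = 720 * (fps_const (1 / 240) * q_deriv E4)"
    unfolding extremal_rec_1 ramanujan_E4[symmetric] by (simp add: numeral_fps_const
        flip: mult.assoc)
  then show ?thesis by simp
qed

text \<open>The second coefficient is carried along because the leading terms of
  \<open>delta_fps * extremal_rec n\<close> and \<open>E6 * extremal_rec (Suc n)\<close> cancel, so
  the next leading coefficient depends on it. The factor \<open>n + 1\<close> clears its
  denominator.\<close>

definition leading_coeffs :: "nat \<Rightarrow> bool" where
  "leading_coeffs n \<longleftrightarrow> (\<forall>i<n. extremal_rec n $ i = 0) \<and> extremal_rec n $ n = 1 \<and>
     (of_nat n + 1) * extremal_rec n $ Suc n = 12 * of_nat n * (4 * of_nat n - 1)"

text \<open>The recursion yields the vanishing and the leading coefficient. For the second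
  coefficient it would require third coefficients of its predecessors, so the differential system is
  used instead.\<close>

lemma leading_coeffs_step:
  assumes "leading_coeffs n" "leading_coeffs (Suc n)"
  shows "leading_coeffs (Suc (Suc n))"
proof -
  define f0 f1 f2 where f: "f0 = extremal_rec n" "f1 = extremal_rec (Suc n)" "f2
      = extremal_rec (Suc (Suc n))"
  define m :: complex where "m = of_nat n"
  define k K where "k = (m + 1) * (m + 2)" and "K = 12 * (6 * m + 7) * (6 * m + 11)"
  have pos: "m + 1 \<noteq> 0" "m + 2 \<noteq> 0" "m + 3 \<noteq> 0" "K \<noteq> 0"
  proof -
    have "m + 1 = of_nat (n + 1)" "m + 2 = of_nat (n + 2)" "m + 3 = of_nat (n + 3)"
      "K = of_nat (12 * (6 * n + 7) * (6 * n + 11))"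
      by (simp_all add: m_def K_def)
    then show "m + 1 \<noteq> 0" "m + 2 \<noteq> 0" "m + 3 \<noteq> 0" "K \<noteq> 0"
      by (simp_all only: of_nat_eq_0_iff) simp
  qed
  have van0: "f0 $ i = 0" if "i < n" for i
    using assms(1) that by (simp add: leading_coeffs_def f)
  have van1: "f1 $ i = 0" if "i < Suc n" for i
    using assms(2) that by (simp add: leading_coeffs_def f)
  have c0: "f0 $ n = 1" "(m + 1) * f0 $ Suc n = 12 * m * (4 * m - 1)"
    using assms(1) by (simp_all add: leading_coeffs_def f m_def)
  have c1: "f1 $ Suc n = 1" "(m + 2) * f1 $ Suc (Suc n) = 12 * (m + 1) * (4 * m + 3)"
    using assms(2) by (simp_all add: leading_coeffs_def f m_def algebra_simps)
  have scalar: "fps_const K = 12 * (6 * of_nat n + 7) * (6 * of_nat n + 11)"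
    "fps_const k = (of_nat n + 1) * (of_nat n + 2)"
    by (simp_all add: K_def k_def m_def numeral_fps_const flip: fps_of_nat fps_const_1_eq_1)
  have rec: "fps_const K * f2 = fps_const k * (delta_fps * f0 - E6 * f1)"
    using extremal_rec_Suc_Suc[of n] unfolding f scalar .
  have rec_nth: "K * f2 $ i = k * ((delta_fps * f0) $ i - (E6 * f1) $ i)" for i
    using arg_cong[OF rec, of "\<lambda>f. f $ i"] by simp
  have prod0: "(g * f0) $ i = 0" if "i < n" for g i
    using that by (simp add: fps_mult_nth van0)
  have prod1: "(g * f1) $ i = 0" if "i < Suc n" for g i
    using that by (simp add: fps_mult_nth van1)
  note small
      = eisenstein_nth_small[unfolded numeral_2_eq_2] delta_fps_nth_small[unfolded numeral_2_eq_2]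
  have van2: "f2 $ i = 0" if "i < Suc (Suc n)" for i
  proof -
    have "i < n \<or> i = n + 0 \<or> i = n + Suc 0" using that by auto
    then consider "i < n" | "i = n + 0" | "i = n + Suc 0" by blast
    \<comment> \<open>Below \<open>n\<close> both sides vanish; at \<open>n\<close> the left one
      does because \<open>delta_fps\<close> has no constant term; at \<open>n + 1\<close> both equal
      1.\<close>
    then have "(delta_fps * f0) $ i = (E6 * f1) $ i"
    proof cases
      case 1
      then show ?thesis by (simp add: prod0 prod1)
    next
      case 2
      then show ?thesis using fps_mult_nth_vanishing[of n f0 delta_fps 0] van0
        by (simp add: prod1 small)
    next
      case 3
      then show ?thesis using fps_mult_nth_vanishing[of n f0 delta_fps "Suc 0"] van0
          fps_mult_nth_vanishing[of "Suc n" f1 E6 0] van1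
        by (simp add: small c0 c1)
    qed
    then show ?thesis using rec_nth[of i] pos by simp
  qed
  have "(delta_fps * f0) $ Suc (Suc n) = f0 $ Suc n - 24"
    using fps_mult_nth_vanishing[of n f0 delta_fps "Suc (Suc 0)"] van0 by (simp add: small c0)
  moreover have "(E6 * f1) $ Suc (Suc n) = f1 $ Suc (Suc n) - 504"
    using fps_mult_nth_vanishing[of "Suc n" f1 E6 "Suc 0"] van1 by (simp add: small c1)
  \<comment> \<open>Here \<open>480 = 504 - 24\<close>, from the linear coefficient of
    \<open>E6\<close> and the quadratic one of \<open>delta_fps\<close>.\<close>
  ultimately have "K * f2 $ Suc (Suc n) = k * (f0 $ Suc n - f1 $ Suc (Suc n) + 480)"
    using rec_nth[of "Suc (Suc n)"] by simp
  also have "\<dots> = K"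
    unfolding k_def K_def using c0(2) c1(2) by algebra
  finally have lead: "f2 $ Suc (Suc n) = 1" using pos by simp
  have scalar': "fps_const (6 * m + 11) = 6 * of_nat (Suc n) + 5"
    "fps_const (12 * (m + 2)) = 12 * (of_nat (Suc n) + 1)"
    by (simp_all add: m_def numeral_fps_const flip: fps_of_nat fps_const_1_eq_1)
  have "12 * (E4 * q_deriv f2) - fps_const (6 * m + 11) * (E2 * E4 * f2)
      = - (fps_const (6 * m + 11) * (E6 * f2)) + fps_const (12 * (m + 2)) * (delta_fps * f1)"
    using conjunct1[OF extremal_rec_system[of "Suc n"]] unfolding f scalar'
    by (simp only: mult.assoc mult_minus_left)
  then have sys: "12 * (E4 * q_deriv f2) $ i - (6 * m + 11) * (E2 * E4 * f2) $ i
      = - ((6 * m + 11) * (E6 * f2) $ i) + 12 * (m + 2) * (delta_fps * f1) $ i" for i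
    unfolding fps_eq_iff by (simp add: numeral_fps_const)
  let ?a = "f2 $ Suc (Suc (Suc n))" and ?N = "Suc (Suc n)"
  have "(E4 * q_deriv f2) $ Suc ?N = (m + 3) * ?a + 240 * (m + 2)"
    using fps_mult_nth_vanishing[of ?N "q_deriv f2" E4 "Suc 0"] van2
    by (simp add: small lead m_def)
  moreover have "(E2 * E4 * f2) $ Suc ?N = ?a + 216"
    using fps_mult_nth_vanishing[of ?N f2 "E2 * E4" "Suc 0"] van2
    by (simp add: small lead fps_mult_nth[of E2 E4])
  moreover have "(E6 * f2) $ Suc ?N = ?a - 504"
    using fps_mult_nth_vanishing[of ?N f2 E6 "Suc 0"] van2 by (simp add: small lead)
  moreover have "(delta_fps * f1) $ Suc ?N = f1 $ Suc (Suc n) - 24"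
    using fps_mult_nth_vanishing[of "Suc n" f1 delta_fps "Suc (Suc 0)"] van1
    by (simp add: small c1)
  \<comment> \<open>Comparison at \<open>q^(n+3)\<close>. The terms \<open>(6 * m + 11) * ?a\<close>
    on the two sides cancel, leaving \<open>12 * (m + 3) * ?a\<close>.\<close>
  ultimately have "12 * ((m + 3) * ?a + 240 * (m + 2)) - (6 * m + 11) * (?a + 216)
      = - ((6 * m + 11) * (?a - 504)) + 12 * (m + 2) * (f1 $ Suc (Suc n) - 24)"
    using sys[of "Suc ?N"] by simp
  then have "(m + 3) * ?a = 12 * (m + 2) * (4 * m + 7)"
    using c1(2) by algebra
  then show ?thesis
    using van2 lead by (simp add: leading_coeffs_def f m_def algebra_simps)
qed

lemma leading_coeffs: "leading_coeffs n"
proof (induction n rule: extremal_rec.induct)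
  case 1
  show ?case by (simp add: leading_coeffs_def)
next
  case 2
  show ?case
    using eisenstein_nth_small(5)
    by (simp add: leading_coeffs_def extremal_rec_1_eq eisenstein_nth_small numeral_2_eq_2)
next
  case (3 n)
  then show ?case by (rule leading_coeffs_step)
qed

lemma extremal_rec_nth: "i < n \<Longrightarrow> extremal_rec n $ i = 0" "extremal_rec n $ n = 1"
  using leading_coeffs[of n] by (simp_all add: leading_coeffs_def)

lemma subdegree_extremal_rec: "subdegree (extremal_rec n) = n"
  by (rule subdegreeI) (simp_all add: extremal_rec_nth)

section \<open>Quasi-modular forms of depth at most one\<close>

lemma finite_qm_exponents: "finite (qm_exponents l w)"
  by (rule finite_subset[of _ "{..w} \<times> {..w} \<times> {..w}"]) (auto simp: qm_exponents_def)

lemma qm_add: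
  assumes "f \<in> quasi_modular_forms l w" "g \<in> quasi_modular_forms l w"
  shows "f + g \<in> quasi_modular_forms l w"
proof -
  obtain u v where
    "f = (\<Sum>(a, b, c)\<in>qm_exponents l w. fps_const (u a b c) * E2 ^ a * E4 ^ b * E6 ^ c)"
    "g = (\<Sum>(a, b, c)\<in>qm_exponents l w. fps_const (v a b c) * E2 ^ a * E4 ^ b * E6 ^ c)"
    using assms unfolding quasi_modular_forms_def by blast
  then have "f + g = (\<Sum>(a, b, c)\<in>qm_exponents l w.
      fps_const (u a b c + v a b c) * E2 ^ a * E4 ^ b * E6 ^ c)"
    by (simp add: case_prod_beta' distrib_right flip: sum.distrib fps_const_add)
  then show ?thesis unfolding quasi_modular_forms_def
    by (intro CollectI exI[of _ "\<lambda>a b c. u a b c + v a b c"])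
qed

lemma qm_scale:
  assumes "f \<in> quasi_modular_forms l w"
  shows "fps_const t * f \<in> quasi_modular_forms l w"
proof -
  obtain u where
    "f = (\<Sum>(a, b, c)\<in>qm_exponents l w. fps_const (u a b c) * E2 ^ a * E4 ^ b * E6 ^ c)"
    using assms unfolding quasi_modular_forms_def by blast
  then have "fps_const t * f = (\<Sum>(a, b, c)\<in>qm_exponents l w.
      fps_const (t * u a b c) * E2 ^ a * E4 ^ b * E6 ^ c)"
    by (simp add: case_prod_beta' sum_distrib_left mult.assoc flip: fps_const_mult)
  then show ?thesis unfolding quasi_modular_forms_def
    by (intro CollectI exI[of _ "\<lambda>a b c. t * u a b c"])
qed

lemma qm_diff:
  assumes "f \<in> quasi_modular_forms l w" "g \<in> quasi_modular_forms l w"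
  shows "f - g \<in> quasi_modular_forms l w"
  using qm_add[OF assms(1) qm_scale[OF assms(2), of "- 1"]] by (simp flip: fps_const_neg)

lemma qm_sum:
  assumes "\<And>x. x \<in> A \<Longrightarrow> f x \<in> quasi_modular_forms l w"
  shows "sum f A \<in> quasi_modular_forms l w"
proof -
  have "0 \<in> quasi_modular_forms l w"
    unfolding quasi_modular_forms_def by (intro CollectI exI[of _ "\<lambda>a b c. 0"]) simp
  then show ?thesis
    using assms by (induction A rule: infinite_finite_induct) (auto intro: qm_add)
qed

lemma qm_monomial:
  assumes "(a, b, c) \<in> qm_exponents l w"
  shows "E2 ^ a * E4 ^ b * E6 ^ c \<in> quasi_modular_forms l w"
proof -
  have "E2 ^ a * E4 ^ b * E6 ^ c = (\<Sum>t\<in>qm_exponents l w.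
      if t = (a, b, c) then E2 ^ a * E4 ^ b * E6 ^ c else 0)"
    using assms by (simp add: finite_qm_exponents)
  also have "\<dots> = (\<Sum>(a', b', c')\<in>qm_exponents l w.
      fps_const (if (a', b', c') = (a, b, c) then 1 else 0) * E2 ^ a' * E4 ^ b' * E6 ^ c')"
    by (intro sum.cong) (auto split: if_splits)
  finally show ?thesis
    unfolding quasi_modular_forms_def
    by (intro CollectI exI[of _ "\<lambda>a' b' c'. if (a', b', c') = (a, b, c) then 1 else 0"])
qed

text \<open>Monomials in \<open>E4\<close> and \<open>E6\<close> shift the weight without raising
  the degree in \<open>E2\<close>.\<close>

lemma qm_mult_monomial:
  assumes "f \<in> quasi_modular_forms l w" "4 * b' + 6 * c' = v"
  shows "E4 ^ b' * E6 ^ c' * f \<in> quasi_modular_forms l (w + v)"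
proof -
  obtain u where
    "f = (\<Sum>(a, b, c)\<in>qm_exponents l w. fps_const (u a b c) * E2 ^ a * E4 ^ b * E6 ^ c)"
    using assms unfolding quasi_modular_forms_def by blast
  then have "E4 ^ b' * E6 ^ c' * f = (\<Sum>(a, b, c)\<in>qm_exponents l w.
      fps_const (u a b c) * (E2 ^ a * E4 ^ (b' + b) * E6 ^ (c' + c)))"
    by (simp add: case_prod_beta' sum_distrib_left power_add mult_ac)
  also have "\<dots> \<in> quasi_modular_forms l (w + v)"
    using assms(2)
    by (intro qm_sum) (auto intro!: qm_scale qm_monomial simp: qm_exponents_def)
  finally show ?thesis .
qed

lemma qm_mult_E6: "f \<in> quasi_modular_forms l w \<Longrightarrow> E6 * f \<in> quasi_modular_forms l (w + 6)"
  using qm_mult_monomial[of f l w 0 1 6] by simp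

lemma qm_mult_delta_fps:
  assumes "f \<in> quasi_modular_forms l w"
  shows "delta_fps * f \<in> quasi_modular_forms l (w + 12)"
proof -
  have "delta_fps * f = fps_const (1 / 1728) * (E4 ^ 3 * E6 ^ 0 * f - E4 ^ 0 * E6 ^ 2 * f)"
    by (simp add: delta_fps_def algebra_simps)
  also have "\<dots> \<in> quasi_modular_forms l (w + 12)"
    using assms by (intro qm_scale qm_diff qm_mult_monomial) simp_all
  finally show ?thesis .
qed

lemma extremal_rec_qm: "extremal_rec n \<in> quasi_modular_forms 1 (6 * n)"
proof (induction n rule: extremal_rec.induct)
  case 1
  show ?case using qm_monomial[of 0 0 0 1 0] by (simp add: qm_exponents_def)
next
  case 2
  have "E2 * E4 \<in> quasi_modular_forms 1 6" "E6 \<in> quasi_modular_forms 1 6"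
    using qm_monomial[of 1 1 0 1 6] qm_monomial[of 0 0 1 1 6] by (simp_all add: qm_exponents_def)
  then show ?case by (simp add: extremal_rec.simps(2) qm_scale qm_diff)
next
  case (3 n)
  have "delta_fps * extremal_rec n \<in> quasi_modular_forms 1 (6 * Suc (Suc n))"
    using qm_mult_delta_fps[OF "3.IH"(1)] by (simp add: add_ac)
  moreover have "E6 * extremal_rec (Suc n) \<in> quasi_modular_forms 1 (6 * Suc (Suc n))"
    using qm_mult_E6[OF "3.IH"(2)] by (simp add: add_ac)
  ultimately show ?case by (simp add: extremal_rec.simps(3) qm_scale qm_diff)
qed

text \<open>In weight \<open>6 (n + 1)\<close> and depth \<open>\<le> 1\<close> there is exactly one monomial without \<open>E6\<close>.\<close>

lemma qm_6_decompose:
  fixes n :: nat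
  obtains x where "\<And>f. f \<in> quasi_modular_forms 1 (6 * Suc n) \<Longrightarrow>
    \<exists>t. \<exists>g\<in>quasi_modular_forms 1 (6 * n). f = fps_const t * x + E6 * g"
proof
  fix f assume "f \<in> quasi_modular_forms 1 (6 * Suc n)"
  then obtain u where f:
    "f = (\<Sum>(a, b, c)\<in>qm_exponents 1 (6 * Suc n). fps_const (u a b c) * E2 ^ a * E4 ^ b * E6 ^ c)"
    unfolding quasi_modular_forms_def by blast
  \<comment> \<open>Without \<open>E6\<close> the weight condition is
    \<open>a + 2 * b = 3 * n + 3\<close> with \<open>a \<le> 1\<close>, so \<open>a\<close> is the
    remainder and \<open>b\<close> the quotient modulo 2. They depend on \<open>n\<close> only, so
    one \<open>x\<close> serves every \<open>f\<close>.\<close>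
  define a0 b0 where "a0 = (3 * n + 3) mod 2" and "b0 = (3 * n + 3) div 2"
  have split: "qm_exponents 1 (6 * Suc n) = insert (a0, b0, 0)
      ((\<lambda>(a, b, c). (a, b, Suc c)) ` qm_exponents 1 (6 * n))"
  proof (intro equalityI subsetI)
    fix s assume "s \<in> qm_exponents 1 (6 * Suc n)"
    then obtain a b c where s: "s = (a, b, c)" "2 * a + 4 * b + 6 * c = 6 * Suc n" "a \<le> 1"
      unfolding qm_exponents_def by auto
    show "s \<in> insert (a0, b0, 0) ((\<lambda>(a, b, c). (a, b, Suc c)) ` qm_exponents 1 (6 * n))"
    proof (cases c)
      case 0
      then have "3 * n + 3 = a + 2 * b" using s by simp
      then have "a0 = a" "b0 = b" using s(3) by (auto simp: a0_def b0_def)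
      then show ?thesis using s 0 by simp
    next
      case (Suc c')
      then have "(a, b, c') \<in> qm_exponents 1 (6 * n)" using s by (simp add: qm_exponents_def)
      then show ?thesis using s Suc by force
    qed
  next
    have "2 * a0 + 4 * b0 = 6 * Suc n"
      unfolding a0_def b0_def by presburger
    then show "s \<in> qm_exponents 1 (6 * Suc n)"
      if "s \<in> insert (a0, b0, 0) ((\<lambda>(a, b, c). (a, b, Suc c)) ` qm_exponents 1 (6 * n))" for s
      using that by (auto simp: qm_exponents_def a0_def)
  qed
  let ?T = "\<lambda>(a, b, c). fps_const (u a b c) * E2 ^ a * E4 ^ b * E6 ^ c"
  have "f = ?T (a0, b0, 0) + sum ?T ((\<lambda>(a, b, c). (a, b, Suc c)) ` qm_exponents 1 (6 * n))"
    unfolding f split by (rule sum.insert) (auto simp: finite_qm_exponents)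
  also have "sum ?T ((\<lambda>(a, b, c). (a, b, Suc c)) ` qm_exponents 1 (6 * n))
      = (\<Sum>(a, b, c)\<in>qm_exponents 1 (6 * n). ?T (a, b, Suc c))"
    by (subst sum.reindex) (auto simp: inj_on_def intro!: sum.cong)
  finally have "f = fps_const (u a0 b0 0) * (E2 ^ a0 * E4 ^ b0) +
      E6 * (\<Sum>(a, b, c)\<in>qm_exponents 1 (6 * n). fps_const (u a b (Suc c)) * (E2 ^ a * E4 ^ b * E6 ^ c))"
    by (simp add: case_prod_beta' sum_distrib_left mult_ac)
  moreover have "(\<Sum>(a, b, c)\<in>qm_exponents 1 (6 * n). fps_const (u a b (Suc c)) * (E2 ^ a * E4 ^ b * E6 ^ c))
      \<in> quasi_modular_forms 1 (6 * n)"
    by (intro qm_sum) (auto intro!: qm_scale qm_monomial)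
  ultimately show "\<exists>t. \<exists>g\<in>quasi_modular_forms 1 (6 * n).
      f = fps_const t * (E2 ^ ((3 * n + 3) mod 2) * E4 ^ ((3 * n + 3) div 2)) + E6 * g"
    unfolding a0_def b0_def by blast
qed

section \<open>Maximal order of vanishing and uniqueness\<close>

lemma E6_nonzero: "E6 \<noteq> 0" and subdegree_E6: "subdegree E6 = 0"
  using eisenstein_nth_small(6) by (auto intro: subdegreeI)

text \<open>The element \<open>extremal_rec (Suc n)\<close> can replace the extra monomial
  \<open>x\<close>, so every form is a multiple of it plus \<open>E6 * r\<close> with
  \<open>r\<close> of weight \<open>6 * n\<close>, to which induction applies.\<close>

lemma qm_subdegree_le:
  assumes "f \<in> quasi_modular_forms 1 (6 * n)" "f \<noteq> 0"
  shows "subdegree f \<le> n"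
  using assms
proof (induction n arbitrary: f)
  case 0
  then obtain u where "f
      = (\<Sum>(a, b, c)\<in>qm_exponents 1 0. fps_const (u a b c) * E2 ^ a * E4 ^ b * E6 ^ c)"
    unfolding quasi_modular_forms_def by auto
  moreover have "qm_exponents 1 0 = {(0, 0, 0)}"
    by (auto simp: qm_exponents_def)
  ultimately show ?case by simp
next
  case (Suc n)
  let ?F = "extremal_rec (Suc n)"
  have F: "?F \<noteq> 0" "subdegree ?F = Suc n"
    using extremal_rec_nth(2)[of "Suc n"] subdegree_extremal_rec by auto
  obtain x where x: "\<And>f. f \<in> quasi_modular_forms 1 (6 * Suc n) \<Longrightarrow>
    \<exists>t. \<exists>g\<in>quasi_modular_forms 1 (6 * n). f = fps_const t * x + E6 * g"
    using qm_6_decompose by blast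
  obtain s g where g: "g \<in> quasi_modular_forms 1 (6 * n)" "?F = fps_const s * x + E6 * g"
    using x[OF extremal_rec_qm] by blast
  obtain t h where h: "h \<in> quasi_modular_forms 1 (6 * n)" "f = fps_const t * x + E6 * h"
    using x[OF Suc.prems(1)] by blast
  \<comment> \<open>Otherwise dividing by \<open>E6\<close>, which preserves the order, would give a
    form of weight \<open>6 * n\<close> and order \<open>n + 1\<close>.\<close>
  have "s \<noteq> 0"
  proof
    assume "s = 0"
    then have "?F = E6 * g" using g by simp
    then have "g \<noteq> 0" "subdegree g = Suc n"
      using F E6_nonzero by (auto simp: subdegree_E6)
    then show False using Suc.IH[OF g(1)] by simp
  qed
  define r where "r = h - fps_const (t / s) * g"
  have r: "r \<in> quasi_modular_forms 1 (6 * n)"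
    unfolding r_def using g h by (intro qm_diff qm_scale)
  have "fps_const (t / s) * ?F = fps_const t * x + E6 * (fps_const (t / s) * g)"
    using \<open>s \<noteq> 0\<close> by (simp add: g(2) distrib_left mult_ac flip: mult.assoc)
  then have fr: "f = fps_const (t / s) * ?F + E6 * r"
    by (simp add: h(2) r_def algebra_simps)
  show ?case
  proof (cases "r = 0")
    case True
    then have "f = fps_const (t / s) * ?F" "fps_const (t / s) \<noteq> 0"
      using fr Suc.prems(2) by auto
    then show ?thesis using F by simp
  next
    case False
    then have "subdegree (E6 * r) \<le> n" "E6 * r \<noteq> 0"
      using Suc.IH[OF r] E6_nonzero by (simp_all add: subdegree_E6)
    \<comment> \<open>At an index at most \<open>n\<close> the summand \<open>?F\<close> contributes
      nothing, so the first nonzero coefficient of \<open>E6 * r\<close> survives in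
      \<open>f\<close>.\<close>
    then have "f $ subdegree (E6 * r) \<noteq> 0"
      using fr extremal_rec_nth(1)[of "subdegree (E6 * r)" "Suc n"] nth_subdegree_nonzero[of "E6 * r"]
      by (simp del: subdegree_mult nth_subdegree_mult)
    then show ?thesis
      using \<open>subdegree (E6 * r) \<le> n\<close> subdegree_leI[of f] by (meson le_SucI order_trans)
  qed
qed

text \<open>For uniqueness: two normalised forms of order \<open>n\<close> differ by a form without
  a term in \<open>q^n\<close>, which must be zero since its order would exceed
  \<open>n\<close>.\<close>

lemma extremal_form_eq: "extremal_form 1 (6 * n) = extremal_rec n"
  unfolding extremal_form_def
proof (rule the_equality)
  have "extremal_rec n \<noteq> 0"
    using extremal_rec_nth(2)[of n] by auto
  then show "is_normalised_extremal 1 (6 * n) (extremal_rec n)"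
    unfolding is_normalised_extremal_def
    using extremal_rec_qm qm_subdegree_le extremal_rec_nth(2)[of n]
    by (simp add: subdegree_extremal_rec)
next
  fix f assume f: "is_normalised_extremal 1 (6 * n) f"
  have F: "extremal_rec n \<noteq> 0"
    using extremal_rec_nth(2)[of n] by auto
  have "n \<le> subdegree f"
    using f F extremal_rec_qm[of n] unfolding is_normalised_extremal_def
    by (metis subdegree_extremal_rec)
  moreover have "subdegree f \<le> n"
    using f qm_subdegree_le unfolding is_normalised_extremal_def by blast
  ultimately have sub: "subdegree f = n" by simp
  show "f = extremal_rec n"
  proof (rule ccontr)
    assume "f \<noteq> extremal_rec n"
    then have nz: "f - extremal_rec n \<noteq> 0" by simp
    have "f $ n = 1" "f $ i = 0" if "i < n" for i
      using f sub that by (auto simp: is_normalised_extremal_def)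
    then have "(f - extremal_rec n) $ i = 0" if "i \<le> n" for i
      using that f sub extremal_rec_nth(1)[of i n] extremal_rec_nth(2)[of n]
      by (cases "i = n") (simp_all add: is_normalised_extremal_def)
    then have "n < subdegree (f - extremal_rec n)"
      using nz by (metis not_less nth_subdegree_nonzero)
    moreover have "subdegree (f - extremal_rec n) \<le> n"
      using f extremal_rec_qm nz by (intro qm_subdegree_le qm_diff) (auto simp: is_normalised_extremal_def)
    ultimately show False by simp
  qed
qed

section \<open>Integrality\<close>

lemma int_adjoin_mono:
  assumes "x \<in> int_adjoin S" "S \<subseteq> T"
  shows "x \<in> int_adjoin T"
  using assms(1) by induction (use assms(2) in \<open>auto intro: int_adjoin.intros\<close>)

lemma int_adjoin_diff:
  assumes "x \<in> int_adjoin S" "y \<in> int_adjoin S"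
  shows "x - y \<in> int_adjoin S"
proof -
  have "x + of_int (- 1) * y \<in> int_adjoin S"
    by (intro int_adjoin.add int_adjoin.mult int_adjoin.of_int assms)
  then show ?thesis by simp
qed

lemma int_adjoin_of_nat: "of_nat m \<in> int_adjoin S"
  using int_adjoin.of_int[of "int m" S] by simp

lemma int_adjoin_sum: "(\<And>x. x \<in> A \<Longrightarrow> f x \<in> int_adjoin S) \<Longrightarrow> sum f A \<in> int_adjoin S"
  using int_adjoin_of_nat[of 0 S]
  by (induction A rule: infinite_finite_induct) (auto intro: int_adjoin.intros)

lemma int_adjoin_fps_mult:
  assumes "\<And>i. f $ i \<in> int_adjoin S" "\<And>i. g $ i \<in> int_adjoin S"
  shows "(f * g) $ n \<in> int_adjoin S"
  unfolding fps_mult_nth using assms by (intro int_adjoin_sum int_adjoin.mult)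

definition primes_inverted :: "nat \<Rightarrow> complex set" where
  "primes_inverted N = int_adjoin {1 / of_nat p | p :: nat. prime p \<and> p < N}"

text \<open>Strong induction: a prime factor of \<open>m\<close> is at most \<open>m\<close>, hence
  below \<open>N\<close>, and the cofactor is smaller than \<open>m\<close>.\<close>

lemma primes_inverted_inverse:
  assumes "0 < m" "m < N"
  shows "1 / of_nat m \<in> primes_inverted N"
  using assms
proof (induction m rule: less_induct)
  case (less m)
  show ?case
  proof (cases "m = 1")
    case True
    then show ?thesis using int_adjoin_of_nat[of 1, where 'a
        = complex] by (simp add: primes_inverted_def)
  next
    case False
    then obtain p where p: "prime p" "p dvd m" using prime_factor_nat by blast
    then obtain k where m: "m = p * k" by blast
    have "p \<le> m" using p less.prems by (simp add: dvd_imp_le)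
    then have "p < N" using less.prems by simp
    have "0 < k" using less.prems m by (cases k) simp_all
    have "k < m" using \<open>0 < k\<close> prime_gt_1_nat[OF p(1)] m by simp
    have "1 / of_nat k \<in> primes_inverted N"
      using \<open>0 < k\<close> \<open>k < m\<close> less.prems by (intro less.IH) simp_all
    moreover have "1 / of_nat p \<in> primes_inverted N"
      unfolding primes_inverted_def using p \<open>p < N\<close> by (intro int_adjoin.gen) blast
    ultimately have "1 / of_nat p * (1 / of_nat k) \<in> primes_inverted N"
      unfolding primes_inverted_def by (intro int_adjoin.mult)
    then show ?thesis by (simp add: m)
  qed
qed

lemma eisenstein_nth_int_adjoin:
  "E2 $ n \<in> int_adjoin S" "E4 $ n \<in> int_adjoin S" "E6 $ n \<in> int_adjoin S"
proof -
  have "E2 $ n = of_int (if n = 0 then 1 else - 24 * int (divisor_sum 1 n))"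
    "E4 $ n = of_int (if n = 0 then 1 else 240 * int (divisor_sum 3 n))"
    "E6 $ n = of_int (if n = 0 then 1 else - 504 * int (divisor_sum 5 n))"
    by (simp_all add: E2_def E4_def E6_def)
  then show "E2 $ n \<in> int_adjoin S" "E4 $ n \<in> int_adjoin S" "E6 $ n \<in> int_adjoin S"
    by (simp_all only: int_adjoin.of_int)
qed

lemma primes_inverted_div:
  assumes "x \<in> primes_inverted N" "0 < m" "m < N"
  shows "x / of_nat m \<in> primes_inverted N"
  using int_adjoin.mult[OF assms(1)[unfolded primes_inverted_def]
      primes_inverted_inverse[OF assms(2,3), unfolded primes_inverted_def]]
  by (simp add: primes_inverted_def)

lemma delta_fps_nth_primes_inverted:
  assumes "6 \<le> N"
  shows "delta_fps $ n \<in> primes_inverted N"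
proof -
  have "(E4 * E4 * E4 - E6 * E6) $ n \<in> primes_inverted N"
    unfolding primes_inverted_def fps_sub_nth
    by (intro int_adjoin_diff int_adjoin_fps_mult eisenstein_nth_int_adjoin)
  \<comment> \<open>\<open>1728 = 4^3 * 3^3\<close>, and each of the six divisors is below
    6.\<close>
  then have "(E4 * E4 * E4
      - E6 * E6) $ n / of_nat 4 / of_nat 4 / of_nat 4 / of_nat 3 / of_nat 3 / of_nat 3
      \<in> primes_inverted N"
    using assms by (intro primes_inverted_div) auto
  then show ?thesis
    by (simp add: delta_fps_def power3_eq_cube power2_eq_square)
qed

lemma primes_inverted_mono: "M \<le> N \<Longrightarrow> x \<in> primes_inverted M \<Longrightarrow> x \<in> primes_inverted N"
  unfolding primes_inverted_def by (erule int_adjoin_mono) auto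

lemma extremal_rec_nth_primes_inverted: "extremal_rec n $ i \<in> primes_inverted (6 * n)"
proof (induction n arbitrary: i rule: extremal_rec.induct)
  case 1
  show ?case
    using int_adjoin_of_nat[of 0, where 'a = complex] int_adjoin_of_nat[of 1, where 'a = complex]
    by (simp add: primes_inverted_def)
next
  case 2
  \<comment> \<open>The factor 240 of \<open>E4\<close> cancels, so this series has integer
    coefficients.\<close>
  have "extremal_rec (Suc 0) $ i = of_nat (i * divisor_sum 3 i)"
    by (simp add: extremal_rec_1_eq E4_def)
  then show ?case
    by (simp add: primes_inverted_def int_adjoin_of_nat del: of_nat_mult)
next
  case (3 n)
  let ?N = "6 * Suc (Suc n)"
  have "delta_fps $ i \<in> primes_inverted ?N" "extremal_rec n $ i \<in> primes_inverted ?N"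
    "extremal_rec (Suc n) $ i \<in> primes_inverted ?N" for i
    using delta_fps_nth_primes_inverted[of ?N] primes_inverted_mono[OF _ "3.IH"(1), of ?N]
      primes_inverted_mono[OF _ "3.IH"(2), of ?N] by simp_all
  then have "of_nat ((n + 1) * (n + 2)) * (delta_fps * extremal_rec n
      - E6 * extremal_rec (Suc n)) $ i
      \<in> primes_inverted ?N"
    unfolding primes_inverted_def fps_sub_nth
    by (intro int_adjoin.mult int_adjoin_of_nat int_adjoin_diff int_adjoin_fps_mult
        eisenstein_nth_int_adjoin) simp_all
  \<comment> \<open>With \<open>12 = 3 * 4\<close> every divisor is below \<open>?N\<close>; the
    largest, \<open>6 * n + 11\<close>, equals \<open>?N - 1\<close>, which is where the bound on
    the primes comes from.\<close>
  then have "of_nat ((n + 1) * (n + 2)) * (delta_fps * extremal_rec n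
      - E6 * extremal_rec (Suc n)) $ i
      / of_nat 3 / of_nat 4 / of_nat (6 * n + 7) / of_nat (6 * n + 11) \<in> primes_inverted ?N"
    by (intro primes_inverted_div) auto
  moreover have "a * x / b / c / d / e = a / (b * c * d * e) * x" for a b c d e x :: complex
    by simp
  ultimately show ?case
    unfolding extremal_rec.simps(3) fps_mult_left_const_nth of_nat_mult
    by simp
qed

theorem theorem3:
  fixes k n :: nat
  shows "fps_nth (extremal_form 1 (6 * k)) n
           \<in> int_adjoin {1 / of_nat p | p :: nat. prime p \<and> p < 6 * k}"
  using extremal_rec_nth_primes_inverted[of k n]
  unfolding extremal_form_eq primes_inverted_def .

end
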